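(* Let $K_{p,q}$ be the complete bipartite graph with partitions of sizes $p$ and $q$, where $p,q\geq 1$. Then the spectrum of $M_{DS}(K_{p,q})$ is $$\left\{ \pm \sqrt{pq}\cdot \frac{\sqrt{p^2+q^2}}{p+q},\ \underbrace{0,\dots,0}_{p+q-2\ \text{times}} \right\}$$ (as a multiset of eigenvalues).
   Context: For a finite simple graph $G$ with vertices $v_1,\dots,v_n$ and degrees $d_i=d_{v_i}$, the diminished Sombor matrix $M_{DS}(G)=(\mu_{ij})$ is the $n\times n$ real symmetric matrix with $\mu_{ij}=\frac{\sqrt{d_i^2+d_j^2}}{d_i+d_j}$ if $v_iv_j\in E(G)$, and $\mu_{ij}=0$ otherwise. *)

theory Defs
  imports
    Complex_Main
    "HOL-Library.Multiset"
    "Graph_Theory.Graph_Theory"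
    "Jordan_Normal_Form.Spectral_Radius"
begin

text \<open>
  Finite simple graphs are the locale \<open>graph\<close> of \<open>Graph_Theory\<close>: finite symmetric digraphs
  without loops and parallel arcs, an edge \<open>uv\<close> being the pair of arcs \<open>(u,v)\<close>, \<open>(v,u)\<close>.
  Hence the number of edges at a vertex is its out-degree (the sum of in- and out-degree would
  count every edge twice).  The list \<open>vs\<close> is the enumeration \<open>v_1, ..., v_n\<close> of the vertices,
  with indices starting from 0.
\<close>

definition diminished_sombor_matrix :: "('a, 'b) pre_digraph \<Rightarrow> 'a list \<Rightarrow> real mat" where
  "diminished_sombor_matrix G vs = mat (length vs) (length vs) (\<lambda>(i, j).
     let d = (\<lambda>k. real (out_degree G (vs ! k))) in
     if vs ! i \<rightarrow>\<^bsub>G\<^esub> vs ! j then sqrt ((d i)\<^sup>2 + (d j)\<^sup>2) / (d i + d j) else 0)"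

text \<open>
  The eigenvalues lying in the ground field, with algebraic multiplicity.  A real \<open>n \<times> n\<close>
  matrix whose multiset has size \<open>n\<close> has no further eigenvalues over the complex numbers.
\<close>

definition eigenvalue_mset :: "'a :: field mat \<Rightarrow> 'a multiset" where
  "eigenvalue_mset A = proots (char_poly A)"

lemma
  assumes "A \<in> carrier_mat n n"
  shows count_eigenvalue_mset: "count (eigenvalue_mset A) x = order x (char_poly A)"
    and set_mset_eigenvalue_mset: "set_mset (eigenvalue_mset A) = spectrum A"
proof -
  have "char_poly A \<noteq> 0"
    using degree_monic_char_poly[OF assms] by auto
  then show "count (eigenvalue_mset A) x = order x (char_poly A)"
    and "set_mset (eigenvalue_mset A) = spectrum A"
    by (simp_all add: eigenvalue_mset_def spectrum_root_char_poly[OF assms])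
qed

end

theory Submission
  imports Defs
begin

text \<open>
  With \<open>u\<close>, \<open>v\<close> the indicator vectors of the two parts and \<open>c\<close> the common nonzero entry, the matrix
  is \<open>c (u v\<^sup>T + v u\<^sup>T)\<close>, a product of an \<open>n \<times> 2\<close> and a \<open>2 \<times> n\<close> matrix.  Reversing the product
  changes the characteristic polynomial only by a power of the variable, and leaves the
  \<open>2 \<times> 2\<close> matrix with rows \<open>(0, c q)\<close> and \<open>(c p, 0)\<close>, whose eigenvalues are \<open>\<plusminus> c \<surd>(p q)\<close>.
\<close>

lemma char_poly_four_block_upper_right_zero:
  fixes A :: "'a :: idom mat"
  assumes A: "A \<in> carrier_mat n n" and C: "C \<in> carrier_mat m n" and D: "D \<in> carrier_mat m m"
  shows "char_poly (four_block_mat A (0\<^sub>m n m) C D) = char_poly A * char_poly D"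
proof -
  have "char_poly_matrix (four_block_mat A (0\<^sub>m n m) C D) =
      four_block_mat (char_poly_matrix A) (0\<^sub>m n m) (map_mat (\<lambda>a. [:- a:]) C) (char_poly_matrix D)"
    unfolding char_poly_matrix_def by (rule eq_matI) (use A C D in \<open>auto simp: one_poly_def\<close>)
  then show ?thesis
    unfolding char_poly_def using A C D
    by (simp add: det_four_block_mat_upper_right_zero[of _ n _ m])
qed

lemma char_poly_zero_mat: "char_poly (0\<^sub>m n n :: 'a :: idom mat) = [:0, 1:] ^ n"
proof -
  have "diag_mat (0\<^sub>m n n :: 'a mat) = replicate n 0"
    by (intro nth_equalityI) (auto simp: diag_mat_def)
  then show ?thesis
    by (subst char_poly_upper_triangular[of _ n]) (auto simp: prod_list_replicate)
qed

text \<open>The block matrices \<open>?X\<close> and \<open>?Y\<close> are similar through the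
  unipotent \<open>?P\<close>, and both are block lower triangular: one has diagonal blocks
  \<open>A * B\<close> and zero, the other zero and \<open>B * A\<close>. Keeping a power of the
  variable on each side avoids any assumption on the order of \<open>m\<close> and
  \<open>n\<close>.\<close>

lemma char_poly_mult_commute:
  fixes A B :: "'a :: idom mat"
  assumes A: "A \<in> carrier_mat n m" and B: "B \<in> carrier_mat m n"
  shows "char_poly (A * B) * [:0, 1:] ^ m = [:0, 1:] ^ n * char_poly (B * A)"
proof -
  let ?X = "four_block_mat (A * B) (0\<^sub>m n m) B (0\<^sub>m m m)"
  let ?Y = "four_block_mat (0\<^sub>m n n) (0\<^sub>m n m) B (B * A)"
  let ?P = "four_block_mat (1\<^sub>m n) A (0\<^sub>m m n) (1\<^sub>m m)"
  let ?Q = "four_block_mat (1\<^sub>m n) (- A) (0\<^sub>m m n) (1\<^sub>m m)"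
  have AB: "A * B \<in> carrier_mat n n" and BA: "B * A \<in> carrier_mat m m"
    using A B by auto
  have nA: "- A \<in> carrier_mat n m"
    using A by auto
  have cancel: "A + - A = 0\<^sub>m n m" "- A + A = 0\<^sub>m n m"
    using A by (auto intro!: eq_matI)
  have neg_zero: "- (0\<^sub>m m m) = (0\<^sub>m m m :: 'a mat)"
    by (rule eq_matI) auto
  have PQ: "?P * ?Q = 1\<^sub>m (n + m)"
    by (subst mult_four_block_mat[OF one_carrier_mat A zero_carrier_mat one_carrier_mat
          one_carrier_mat nA zero_carrier_mat one_carrier_mat])
      (use A in \<open>simp add: cancel neg_zero\<close>)
  have QP: "?Q * ?P = 1\<^sub>m (n + m)"
    by (subst mult_four_block_mat[OF one_carrier_mat nA zero_carrier_mat one_carrier_mat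
          one_carrier_mat A zero_carrier_mat one_carrier_mat])
      (use A in \<open>simp add: cancel neg_zero\<close>)
  have PY: "?P * ?Y = four_block_mat (A * B) (A * (B * A)) B (B * A)"
    by (subst mult_four_block_mat[OF one_carrier_mat A zero_carrier_mat one_carrier_mat
          zero_carrier_mat zero_carrier_mat B BA])
      (use A B in simp)
  have XP: "?X * ?P = four_block_mat (A * B) (A * (B * A)) B (B * A)"
    by (subst mult_four_block_mat[OF AB zero_carrier_mat B zero_carrier_mat
          one_carrier_mat A zero_carrier_mat one_carrier_mat])
      (use A B in simp)
  have carr: "{?X, ?Y, ?P, ?Q} \<subseteq> carrier_mat (n + m) (n + m)"
    using A B by auto
  \<comment> \<open>\<open>PY\<close> and \<open>XP\<close> have the same right-hand side, so
    \<open>?P\<close> intertwines \<open>?Y\<close> and \<open>?X\<close>; its inverse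
    \<open>?Q\<close> then cancels.\<close>
  have "?P * ?Y * ?Q = ?X * (?P * ?Q)"
    unfolding PY XP[symmetric] by (rule assoc_mult_mat) (use carr in auto)
  also have "\<dots> = ?X"
    unfolding PQ using carr by (intro right_mult_one_mat) auto
  finally have "similar_mat ?X ?Y"
    by (intro similar_matI[OF carr PQ QP]) simp
  from char_poly_similar[OF this] show ?thesis
    using A B AB BA by (simp add: char_poly_four_block_upper_right_zero char_poly_zero_mat)
qed

lemma char_poly_antidiagonal_2:
  fixes a b :: "'a :: idom"
  shows "char_poly (mat 2 2 (\<lambda>(i, j). if i = j then 0 else if i = 0 then a else b)) =
    [:- (a * b), 0, 1:]"
proof -
  let ?E = "\<lambda>x. mat 1 1 (\<lambda>_. x) :: 'a poly mat"
  have "char_poly_matrix (mat 2 2 (\<lambda>(i, j). if i = j then 0 else if i = 0 then a else b)) =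
      four_block_mat (?E [:0, 1:]) (?E [:- a:]) (?E [:- b:]) (?E [:0, 1:])"
    unfolding char_poly_matrix_def by (rule eq_matI) (auto simp: less_2_cases_iff)
  \<comment> \<open>The block determinant formula asks the two lower blocks to commute, which is
    automatic for 1 by 1 matrices.\<close>
  moreover have "det \<dots> = det (?E [:0, 1:] * ?E [:0, 1:] - ?E [:- a:] * ?E [:- b:])"
    by (rule det_four_block_mat[of _ 1]) (auto intro!: eq_matI simp: scalar_prod_def)
  moreover have "\<dots> = [:- (a * b), 0, 1:]"
    by (subst det_single) (auto simp: scalar_prod_def)
  ultimately show ?thesis
    by (simp only: char_poly_def)
qed

lemma sum_of_bool_nth:
  assumes "distinct xs"
  shows "(\<Sum>i < length xs. of_bool (xs ! i \<in> S)) = (of_nat (card (set xs \<inter> S)) :: 'a :: semiring_1)"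
proof -
  have "(\<Sum>i < length xs. of_bool (xs ! i \<in> S)) = (\<Sum>x\<in>set xs. of_bool (x \<in> S) :: 'a)"
    by (rule sum.reindex_bij_betw[OF bij_betw_nth[OF assms]]) auto
  then show ?thesis
    by (simp add: sum_of_bool_eq)
qed

text \<open>The squared variable on the left comes from the inner dimension 2 of the factorization.
  It stays there so that no truncated subtraction \<open>p + q - 2\<close> occurs and empty parts
  are covered too.\<close>

lemma char_poly_bipartite:
  fixes c :: "'a :: idom"
  assumes "distinct vs" and vs: "set vs = U \<union> V" and disj: "U \<inter> V = {}"
    and "card U = p" and "card V = q"
  shows "char_poly (mat (length vs) (length vs)
      (\<lambda>(i, j). if (vs ! i, vs ! j) \<in> U \<times> V \<union> V \<times> U then c else 0)) * [:0, 1:]\<^sup>2 =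
    [:0, 1:] ^ (p + q) * [:- (c\<^sup>2 * of_nat (p * q)), 0, 1:]"
proof -
  define n where "n = length vs"
  \<comment> \<open>The columns of \<open>A\<close> are the indicators of \<open>U\<close> and
    \<open>V\<close>, scaled by \<open>c\<close>; the rows of \<open>B\<close> are the unscaled
    indicators in the opposite order, so that \<open>A * B\<close> pairs each part with the other
    one.\<close>
  define A where "A = mat n 2 (\<lambda>(i, k). c * of_bool (vs ! i \<in> (if k = 0 then U else V)))"
  define B where "B = mat 2 n (\<lambda>(k, j). of_bool (vs ! j \<in> (if k = 0 then V else U)) :: 'a)"
  have A: "A \<in> carrier_mat n 2" and B: "B \<in> carrier_mat 2 n"
    by (auto simp: A_def B_def)
  have fin: "finite U" "finite V"
    using vs by (metis finite_set finite_Un)+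
  have n: "n = p + q"
    unfolding n_def using assms fin by (metis distinct_card card_Un_disjoint)
  have AB: "A * B = mat n n (\<lambda>(i, j). if (vs ! i, vs ! j) \<in> U \<times> V \<union> V \<times> U then c else 0)"
    by (rule eq_matI)
      (use disj in \<open>auto simp: A_def B_def scalar_prod_def numeral_2_eq_2\<close>)
  have cards: "(\<Sum>i<n. of_bool (vs ! i \<in> U)) = (of_nat p :: 'a)"
    "(\<Sum>i<n. of_bool (vs ! i \<in> V)) = (of_nat q :: 'a)"
    unfolding n_def using assms by (simp_all only: sum_of_bool_nth vs) (simp_all add: Int_absorb1)
  have entries: "(B * A) $$ (k, l) = (if k = l then 0 else if k = 0 then c * of_nat q else c * of_nat p)"
    if "k < 2" "l < 2" for k l
  proof -
    have "(B * A) $$ (k, l) = (\<Sum>i<n. of_bool (vs ! i \<in> (if k = 0 then V else U)) *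
        (c * of_bool (vs ! i \<in> (if l = 0 then U else V))))"
      using that by (auto simp: A_def B_def scalar_prod_def atLeast0LessThan)
    \<comment> \<open>A product of indicators is the indicator of the intersection: empty on the
      diagonal, where \<open>U\<close> meets \<open>V\<close>, and a whole part off the
      diagonal.\<close>
    also have "\<dots> = (\<Sum>i<n. c * of_bool (vs ! i \<in> (if k = 0 then V else U) \<inter> (if l = 0 then U else V)))"
      by (rule sum.cong) auto
    also have "\<dots> = (if k = l then 0 else if k = 0 then c * of_nat q else c * of_nat p)"
      using that disj
      by (auto simp: less_2_cases_iff cards Int_commute[of V U] simp flip: sum_distrib_left
          simp del: sum_of_bool_eq Int_iff)
    finally show ?thesis .
  qed
  have "B * A = mat 2 2 (\<lambda>(i, j). if i = j then 0 else if i = 0 then c * of_nat q else c * of_nat p)"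
    by (rule eq_matI) (use A B entries in auto)
  then have "char_poly (B * A) = [:- (c\<^sup>2 * of_nat (p * q)), 0, 1:]"
    by (simp add: char_poly_antidiagonal_2 power2_eq_square algebra_simps)
  then show ?thesis
    using char_poly_mult_commute[OF A B] by (simp add: AB n n_def[symmetric])
qed

text \<open>Without parallel arcs, \<open>head G\<close> is injective on the arcs leaving
  \<open>u\<close>. Degrees can thus be read off \<open>arcs_ends G\<close>, which is how complete
  bipartite graphs are specified.\<close>

lemma (in nomulti_digraph) out_degree_eq_card_successors:
  "out_degree G u = card {v. u \<rightarrow>\<^bsub>G\<^esub> v}"
proof -
  have "bij_betw (head G) (out_arcs G u) {v. u \<rightarrow>\<^bsub>G\<^esub> v}"
    unfolding bij_betw_def
  proof
    show "inj_on (head G) (out_arcs G u)"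
      using no_multi_arcs by (auto simp: inj_on_def arc_to_ends_def)
    show "head G ` out_arcs G u = {v. u \<rightarrow>\<^bsub>G\<^esub> v}"
      by (force simp: arcs_ends_def arc_to_ends_def)
  qed
  then show ?thesis
    unfolding out_degree_def by (rule bij_betw_same_card)
qed

text \<open>Every vertex of \<open>U\<close> has degree \<open>q\<close> and every vertex of
  \<open>V\<close> has degree \<open>p\<close>. Since the weight is symmetric in the two degrees,
  all edges carry the same one.\<close>

lemma diminished_sombor_matrix_complete_bipartite:
  assumes "graph G" and verts: "set vs = U \<union> V" and disj: "U \<inter> V = {}"
    and "card U = p" and "card V = q" and arcs: "arcs_ends G = U \<times> V \<union> V \<times> U"
  shows "diminished_sombor_matrix G vs = mat (length vs) (length vs)
    (\<lambda>(i, j). if (vs ! i, vs ! j) \<in> U \<times> V \<union> V \<times> U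
      then sqrt ((real p)\<^sup>2 + (real q)\<^sup>2) / (real p + real q) else 0)"
proof -
  interpret graph G by fact
  have "{v. u \<rightarrow>\<^bsub>G\<^esub> v} = V" if "u \<in> U" for u
    using arcs disj that by auto
  then have U: "out_degree G u = q" if "u \<in> U" for u
    using that assms by (simp add: out_degree_eq_card_successors)
  have "{v. u \<rightarrow>\<^bsub>G\<^esub> v} = U" if "u \<in> V" for u
    using arcs disj that by auto
  then have V: "out_degree G u = p" if "u \<in> V" for u
    using that assms by (simp add: out_degree_eq_card_successors)
  show ?thesis
    unfolding diminished_sombor_matrix_def
    by (rule cong_mat) (auto simp: arcs U V Let_def add.commute)
qed

theorem theorem3p4:
  fixes G :: "('a, 'b) pre_digraph" and vs :: "'a list" and p q :: nat
  assumes "p \<ge> 1" and "q \<ge> 1"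
    and "K\<^bsub>p,q\<^esub> G"
    and "distinct vs" and "set vs = verts G"
  shows "eigenvalue_mset (diminished_sombor_matrix G vs) =
    {# sqrt (real p * real q) * (sqrt ((real p)\<^sup>2 + (real q)\<^sup>2) / (real p + real q)),
       - (sqrt (real p * real q) * (sqrt ((real p)\<^sup>2 + (real q)\<^sup>2) / (real p + real q))) #}
    + replicate_mset (p + q - 2) 0"
proof -
  define c where "c = sqrt ((real p)\<^sup>2 + (real q)\<^sup>2) / (real p + real q)"
  define r where "r = sqrt (real p * real q) * c"
  let ?M = "diminished_sombor_matrix G vs"
  from assms(3) obtain U V where UV: "graph G" "verts G = U \<union> V" "U \<inter> V = {}"
    "card U = p" "card V = q" "arcs_ends G = U \<times> V \<union> V \<times> U"
    unfolding complete_bipartite_digraph_def by blast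
  have M: "?M = mat (length vs) (length vs)
      (\<lambda>(i, j). if (vs ! i, vs ! j) \<in> U \<times> V \<union> V \<times> U then c else 0)"
    unfolding c_def using UV assms(5)
    by (intro diminished_sombor_matrix_complete_bipartite) auto
  have "r\<^sup>2 = c\<^sup>2 * real (p * q)"
    by (simp add: r_def power_mult_distrib)
  then have factor: "[:- (c\<^sup>2 * real (p * q)), 0, 1:] = [:- r, 1:] * [:r, 1:]"
    by (simp add: power2_eq_square)
  have "char_poly ?M * [:0, 1:]\<^sup>2 = [:0, 1:] ^ (p + q) * ([:- r, 1:] * [:r, 1:])"
    unfolding M factor[symmetric] using UV assms(4,5)
    by (intro char_poly_bipartite) auto
  \<comment> \<open>Both parts are nonempty, so \<open>p + q - 2\<close> is a true difference, and
    the squared variable can be cancelled next. Linear factors are kept unexpanded there so that the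
    common factor remains visible.\<close>
  also have "[:0, 1:] ^ (p + q) = [:0, 1:] ^ (p + q - 2) * [:0, 1 :: real:]\<^sup>2"
    using assms(1,2) by (metis power_add le_add_diff_inverse2 one_add_one add_mono)
  finally have "char_poly ?M = [:- r, 1:] * [:r, 1:] * [:0, 1:] ^ (p + q - 2)"
    by (simp add: ac_simps del: mult_pCons_left mult_pCons_right)
  then have "eigenvalue_mset ?M = proots ([:- r, 1:] * [:r, 1:] * [:0, 1:] ^ (p + q - 2))"
    by (simp only: eigenvalue_mset_def)
  also have "\<dots> = {#r, - r#} + replicate_mset (p + q - 2) 0"
    \<comment> \<open>\<open>proots\<close> is additive only on products of nonzero polynomials; the
      two inner calls of \<open>simp\<close> check this.\<close>
    by (subst proots_mult, simp, simp)+ (simp add: proots_power)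
  finally show ?thesis
    by (simp add: r_def c_def)
qed

end
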